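(* Let $X$ be a Banach space. If $x^*\in S_{X^*}$ can be written as $x^*=\sum_{i=1}^\infty \lambda_i f_i$, where $\lambda_i\ge 0$ for all $i$, $\sum_{i=1}^\infty\lambda_i=1$, and the $f_i$ are strongly exposed points (respectively, $w^*$-strongly exposed points) of $B_{X^*}$, then $x^*$ is not a Daugavet-point of $X^*$. In particular, if $\mathcal{A}$ is an adequate family of finite subsets of $\mathbb{N}$, then $h_{\mathcal{A},1}^*$ does not have Daugavet-points.
   Context: All Banach spaces are real. $B_X$, $S_X$, $X^*$ denote the closed unit ball, unit sphere and topological dual of a Banach space $X$. Slices: for a Banach space $Y$, $f\in S_{Y^*}$ and $\delta>0$, $S(f,\delta)=\{y\in B_Y : f(y)>1-\delta\}$. Daugavet-point: $x\in S_Y$ is a Daugavet-point of $Y$ if for every slice $S(f,\delta)$ of $B_Y$ and every $\varepsilon>0$ there exists $y\in S(f,\delta)$ with $\|x-y\|\ge 2-\varepsilon$. (Here $Y=X^*$, so slices are given by functionals in $S_{X^{**}}$.) Strongly exposed: $f\in B_{X^*}$ is a strongly exposed point of $B_{X^*}$ if there is $x^{**}\in S_{X^{**}}$ with $x^{**}(f)=1$ such that $\|f_n-f\|\to0$ whenever $(f_n)\subset B_{X^*}$ and $x^{**}(f_n)\to1$; it is $w^*$-strongly exposed if $x^{**}$ can be taken in $S_X\subset S_{X^{**}}$. Adequate family: a family $\mathcal{A}$ of subsets of $\mathbb{N}=\{1,2,\dots\}$ is adequate if (1) it contains the empty set and all singletons $\{i\}$, $i\in\mathbb{N}$; (2) it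 is hereditary: $A\in\mathcal{A}$ and $B\subseteq A$ imply $B\in\mathcal{A}$; (3) it is compact for pointwise convergence, i.e. given $A\subset\mathbb{N}$, if every finite subset of $A$ is in $\mathcal{A}$, then $A\in\mathcal{A}$. An adequate family of finite subsets is one all of whose members are finite. The space $h_{\mathcal{A},1}$: the completion of the space $c_{00}$ of finitely supported sequences, with standard basis $(e_i)_{i\in\mathbb{N}}$, in the norm $\left\|\sum_{i=1}^n a_i e_i\right\| = \sup_{A\in\mathcal{A}}\sum_{i\in A}|a_i|$ (with $a_i=0$ for $i>n$). *)

theory Defs
  imports "HOL-Analysis.Analysis"
begin

section \<open>Slices, Daugavet-points and strongly exposed points\<close>

text \<open>The dual of a normed space \<open>'a\<close> is the type \<open>'a \<Rightarrow>\<^sub>L real\<close>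
  with the operator norm, and the bidual is \<open>('a \<Rightarrow>\<^sub>L real) \<Rightarrow>\<^sub>L real\<close>.\<close>

definition slice :: "('y::real_normed_vector \<Rightarrow>\<^sub>L real) \<Rightarrow> real \<Rightarrow> 'y set" where
  "slice f \<delta> = {y \<in> cball 0 1. blinfun_apply f y > 1 - \<delta>}"

definition daugavet_point :: "'y::real_normed_vector \<Rightarrow> bool" where
  "daugavet_point x \<longleftrightarrow>
     x \<in> sphere 0 1 \<and>
     (\<forall>f \<in> sphere 0 1. \<forall>\<delta>>0. \<forall>\<epsilon>>0. \<exists>y \<in> slice f \<delta>. norm (x - y) \<ge> 2 - \<epsilon>)"

definition strongly_exposed_by ::
    "'y::real_normed_vector \<Rightarrow> ('y \<Rightarrow>\<^sub>L real) \<Rightarrow> bool" where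
  "strongly_exposed_by f \<phi> \<longleftrightarrow>
     f \<in> cball 0 1 \<and> blinfun_apply \<phi> f = 1 \<and>
     (\<forall>g :: nat \<Rightarrow> 'y. (\<forall>n. g n \<in> cball 0 1) \<and> (\<lambda>n. blinfun_apply \<phi> (g n)) \<longlonglongrightarrow> 1
        \<longrightarrow> (\<lambda>n. norm (g n - f)) \<longlonglongrightarrow> 0)"

definition strongly_exposed :: "'y::real_normed_vector \<Rightarrow> bool" where
  "strongly_exposed f \<longleftrightarrow> (\<exists>\<phi> \<in> sphere 0 1. strongly_exposed_by f \<phi>)"

definition bidual_embed :: "'a::real_normed_vector \<Rightarrow> ('a \<Rightarrow>\<^sub>L real) \<Rightarrow>\<^sub>L real" where
  "bidual_embed x = Blinfun (\<lambda>f. blinfun_apply f x)"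

lemma bidual_embed_apply [simp]:
  "blinfun_apply (bidual_embed x) f = blinfun_apply f x"
  unfolding bidual_embed_def
  by (simp add: bounded_linear_Blinfun_apply blinfun.bounded_linear_left)

definition wstar_strongly_exposed :: "('a::real_normed_vector \<Rightarrow>\<^sub>L real) \<Rightarrow> bool" where
  "wstar_strongly_exposed f \<longleftrightarrow>
     (\<exists>x \<in> sphere 0 1. strongly_exposed_by f (bidual_embed x))"


section \<open>Adequate families and the spaces they generate\<close>

text \<open>The index set \<open>{1, 2, \<dots>}\<close> is relabelled as the type \<open>nat\<close>, starting at \<open>0\<close>.\<close>

definition adequate_family :: "nat set set \<Rightarrow> bool" where
  "adequate_family \<A> \<longleftrightarrow>
     {} \<in> \<A> \<and> (\<forall>i. {i} \<in> \<A>) \<and>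
     (\<forall>A B. A \<in> \<A> \<and> B \<subseteq> A \<longrightarrow> B \<in> \<A>) \<and>
     (\<forall>A. (\<forall>F. finite F \<and> F \<subseteq> A \<longrightarrow> F \<in> \<A>) \<longrightarrow> A \<in> \<A>)"

definition c00 :: "(nat \<Rightarrow> real) set" where
  "c00 = {a. finite {i. a i \<noteq> 0}}"

text \<open>Members of \<open>\<A>\<close> may be infinite, and \<open>sum\<close> is \<open>0\<close> over infinite sets, so the
  sum is restricted to the finite support of \<open>a\<close>.\<close>

definition h1_norm :: "nat set set \<Rightarrow> (nat \<Rightarrow> real) \<Rightarrow> real" where
  "h1_norm \<A> a = (SUP A \<in> \<A>. \<Sum>i \<in> A \<inter> {i. a i \<noteq> 0}. \<bar>a i\<bar>)"

text \<open>The completion of \<open>c00\<close> in the norm \<open>h1_norm \<A>\<close> depends on the term \<open>\<A>\<close>, so it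
  cannot be a single type. The predicate below says that the Banach space \<open>'b\<close> is a
  completion, \<open>J\<close> being the canonical linear isometry of \<open>c00\<close> onto a dense subspace;
  this determines \<open>'b\<close> up to isometric isomorphism.\<close>

definition is_h1_completion :: "nat set set \<Rightarrow> ((nat \<Rightarrow> real) \<Rightarrow> 'b::banach) \<Rightarrow> bool" where
  "is_h1_completion \<A> J \<longleftrightarrow>
     (\<forall>a \<in> c00. \<forall>b \<in> c00. \<forall>r s. J (\<lambda>i. r * a i + s * b i) = r *\<^sub>R J a + s *\<^sub>R J b) \<and>
     (\<forall>a \<in> c00. norm (J a) = h1_norm \<A> a) \<and>
     closure (J ` c00) = UNIV"

end

theory Submission
  imports Defs
begin

text \<open>If \<open>c k > 0\<close>, a small slice exposing \<open>f k\<close> lies within \<open>c k\<close> of \<open>f k\<close>, whose distance to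
  \<open>x\<close> is at most \<open>2 - 2 * c k\<close>; hence \<open>x\<close> is not a Daugavet-point.

  For \<open>h\<^sub>\<A>\<^sub>,\<^sub>1\<close>, the signings \<open>\<Sum>i\<in>A. \<plusminus>e\<^sub>i\<^sup>*\<close> with \<open>A \<in> \<A>\<close> form a countable \<open>w\<^sup>*\<close>-compact norming
  set, and those with \<open>A\<close> maximal are \<open>w\<^sup>*\<close>-strongly exposed. If \<open>x\<close> were a Daugavet-point, it would
  have distance 2 from the latter, so that (averaging two maximal ones) each signing \<open>\<sigma>\<close> admits a
  unit-ball vector \<open>a\<close> with \<open>x a\<close> close to 1 and \<open>\<sigma> a < 1/2\<close>. Enumerating the signings and taking
  summable errors, finitely many of these vectors suffice for all signings by compactness; the
  norm of their sum \<open>a\<^sub>1 + \<dots> + a\<^sub>N\<close> is at most \<open>N - 1/2\<close>, but \<open>x\<close> is at least \<open>N - 1/4\<close>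
  on it. No integral representation of \<open>x\<close> is needed.\<close>

section \<open>Convex series of strongly exposed points\<close>

text \<open>If the claim fails, points of the slices of width \<open>1 / Suc n\<close> staying at
  distance \<open>\<eta>\<close> from \<open>f\<close> form a sequence that violates the exposure
  condition; \<open>norm \<phi> \<le> 1\<close> keeps its values at most 1.\<close>

lemma strongly_exposed_by_small_slice:
  assumes se: "strongly_exposed_by f \<phi>" and "norm \<phi> \<le> 1" and "\<eta> > 0"
  obtains \<delta> where "\<delta> > 0" "\<And>y. y \<in> slice \<phi> \<delta> \<Longrightarrow> norm (y - f) < \<eta>"
proof (rule ccontr)
  assume neg: "\<not> thesis"
  have "\<exists>y. y \<in> slice \<phi> (1 / real (Suc n)) \<and> norm (y - f) \<ge> \<eta>" for n
    using neg that[of "1 / real (Suc n)"] by force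
  then obtain g where g: "\<And>n. g n \<in> slice \<phi> (1 / real (Suc n))" "\<And>n. norm (g n - f) \<ge> \<eta>"
    by metis
  have ball: "\<And>n. g n \<in> cball 0 1" using g(1) by (simp add: slice_def)
  have "(\<lambda>n. \<phi> (g n)) \<longlonglongrightarrow> 1"
  proof (rule tendsto_sandwich)
    show "\<forall>\<^sub>F n in sequentially. 1 - 1 / real (Suc n) \<le> \<phi> (g n)"
      using g(1) by (auto simp: slice_def less_imp_le)
    show "\<forall>\<^sub>F n in sequentially. \<phi> (g n) \<le> 1"
    proof (intro always_eventually allI)
      fix n
      have "\<bar>\<phi> (g n)\<bar> \<le> norm \<phi> * norm (g n)" using norm_blinfun[of \<phi> "g n"] by simp
      also have "\<dots> \<le> 1" using ball[of n] \<open>norm \<phi> \<le> 1\<close> by (simp add: mult_le_one)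
      finally show "\<phi> (g n) \<le> 1" by simp
    qed
    show "(\<lambda>n. 1 - 1 / real (Suc n)) \<longlonglongrightarrow> 1"
      using tendsto_diff[OF tendsto_const LIMSEQ_inverse_real_of_nat, of "1::real"]
      by (simp add: inverse_eq_divide)
  qed simp
  then have "(\<lambda>n. norm (g n - f)) \<longlonglongrightarrow> 0"
    using se ball unfolding strongly_exposed_by_def by blast
  then have "\<eta> \<le> 0" by (rule tendsto_lowerbound) (use g(2) in auto)
  then show False using \<open>\<eta> > 0\<close> by simp
qed

lemma norm_bidual_embed_le: "norm (bidual_embed x) \<le> norm x"
proof (rule norm_blinfun_bound)
  show "norm (bidual_embed x f) \<le> norm x * norm f" for f
    using norm_blinfun[of f x] by (simp add: mult.commute)
qed simp

lemma norm_strongly_exposing_ge: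
  assumes "strongly_exposed_by f \<phi>"
  shows "norm \<phi> \<ge> 1"
proof -
  have "\<phi> f = 1" "norm f \<le> 1" using assms by (auto simp: strongly_exposed_by_def)
  then have "1 \<le> norm \<phi> * norm f" using norm_blinfun[of \<phi> f] by simp
  also have "\<dots> \<le> norm \<phi>" using \<open>norm f \<le> 1\<close> by (simp add: mult_left_le)
  finally show ?thesis .
qed

text \<open>The value 1 that \<open>bidual_embed x\<close> takes at \<open>f\<close> in the unit
  ball forces its norm up to 1, and the embedding never increases norms.\<close>

lemma wstar_strongly_exposed_imp_strongly_exposed:
  assumes "wstar_strongly_exposed f"
  shows "strongly_exposed f"
proof -
  obtain x where x: "norm x = 1" "strongly_exposed_by f (bidual_embed x)"
    using assms by (auto simp: wstar_strongly_exposed_def)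
  then have "norm (bidual_embed x) = 1"
    using norm_strongly_exposing_ge[OF x(2)] norm_bidual_embed_le[of x] by linarith
  then show ?thesis using x(2) by (auto simp: strongly_exposed_def)
qed

text \<open>Without the term \<open>k\<close> the weights sum to \<open>1 - c k\<close>, and the
  triangle inequality applies to the remaining series.\<close>

lemma norm_convex_series_remove_le:
  fixes f :: "nat \<Rightarrow> 'y::banach"
  assumes c: "\<And>i. c i \<ge> 0" "c sums 1" and f: "\<And>i. norm (f i) \<le> 1"
    and x: "(\<lambda>i. c i *\<^sub>R f i) sums x"
  shows "norm (x - c k *\<^sub>R f k) \<le> 1 - c k"
proof -
  have "(\<lambda>i. (if i = k then 0 else c i) *\<^sub>R f i) sums (x - c k *\<^sub>R f k)"
    using sums_diff[OF x sums_single[of k "\<lambda>i. c i *\<^sub>R f i"]]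
    by (rule sums_cong[THEN iffD1, rotated]) auto
  moreover have "(\<lambda>i. if i = k then 0 else c i) sums (1 - c k)"
    using sums_diff[OF c(2) sums_single[of k c]]
    by (rule sums_cong[THEN iffD1, rotated]) auto
  ultimately show ?thesis
    by (rule norm_sums_le) (use c f in \<open>auto simp: mult_left_le\<close>)
qed

proposition not_daugavet_point_convex_series_strongly_exposed:
  fixes f :: "nat \<Rightarrow> 'y::banach"
  assumes c: "\<And>i. c i \<ge> 0" "c sums 1" and f: "\<And>i. strongly_exposed (f i)"
    and x: "(\<lambda>i. c i *\<^sub>R f i) sums x"
  shows "\<not> daugavet_point x"
proof
  assume D: "daugavet_point x"
  have "\<exists>k. c k \<noteq> 0"
    using c(2) sums_unique2[of c 1 0] sums_zero by (metis sums_cong zero_neq_one)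
  then obtain k where k: "c k > 0" using c(1) by (metis less_eq_real_def)
  have nf: "norm (f i) \<le> 1" for i
    using f[of i] by (auto simp: strongly_exposed_def strongly_exposed_by_def)
  have rem: "norm (x - c k *\<^sub>R f k) \<le> 1 - c k"
    using norm_convex_series_remove_le[OF c nf x] .
  obtain \<phi> where \<phi>: "\<phi> \<in> sphere 0 1" "strongly_exposed_by (f k) \<phi>"
    using f[of k] by (auto simp: strongly_exposed_def)
  obtain \<delta> where \<delta>: "\<delta> > 0" "\<And>y. y \<in> slice \<phi> \<delta> \<Longrightarrow> norm (y - f k) < c k"
    using strongly_exposed_by_small_slice[OF \<phi>(2) _ k] \<phi>(1) by auto
  obtain y where y: "y \<in> slice \<phi> \<delta>" "norm (x - y) \<ge> 2 - c k"
    using D \<phi>(1) \<delta>(1) k unfolding daugavet_point_def by blast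
  have "c k \<le> 1" using rem norm_ge_zero[of "x - c k *\<^sub>R f k"] by linarith
  then have "norm ((1 - c k) *\<^sub>R f k) \<le> 1 - c k" using nf[of k] by (simp add: mult_left_le)
  \<comment> \<open>The three summands have norms at most \<open>1 - c k\<close>, at most
    \<open>1 - c k\<close> and below \<open>c k\<close>, so their total falls below
    \<open>2 - c k\<close>.\<close>
  moreover have "x - y = (x - c k *\<^sub>R f k) - (1 - c k) *\<^sub>R f k - (y - f k)"
    by (simp add: algebra_simps)
  then have "norm (x - y) \<le> norm (x - c k *\<^sub>R f k) + norm ((1 - c k) *\<^sub>R f k) + norm (y - f k)"
    by (metis (no_types, opaque_lifting) add.commute add_left_mono norm_triangle_ineq4 order_trans)
  ultimately show False using rem \<delta>(2)[OF y(1)] y(2) by linarith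
qed

section \<open>The spaces generated by adequate families\<close>

text \<open>Supports need not be maximal, so that the set is closed under pointwise limits.\<close>

definition signings :: "nat set set \<Rightarrow> (nat \<Rightarrow> real) set" where
  "signings \<A> = {\<sigma>. range \<sigma> \<subseteq> {-1, 0, 1} \<and> {i. \<sigma> i \<noteq> 0} \<in> \<A>}"

text \<open>The sum runs over the support of \<open>a\<close>, so that \<open>pairing \<sigma> a\<close> is continuous in \<open>\<sigma>\<close> for the product
  topology.\<close>

definition pairing :: "(nat \<Rightarrow> real) \<Rightarrow> (nat \<Rightarrow> real) \<Rightarrow> real" where
  "pairing \<sigma> a = (\<Sum>i | a i \<noteq> 0. \<sigma> i * a i)"

section \<open>Linearity of the pairing\<close>

lemma c00_lincomb: "a \<in> c00 \<Longrightarrow> b \<in> c00 \<Longrightarrow> (\<lambda>i. r * a i + s * b i) \<in> c00"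
  unfolding c00_def by (auto intro: finite_subset[of _ "{i. a i \<noteq> 0} \<union> {i. b i \<noteq> 0}"])

lemma pairing_eq_sum:
  assumes "finite S" "{i. a i \<noteq> 0} \<subseteq> S"
  shows "pairing \<sigma> a = (\<Sum>i\<in>S. \<sigma> i * a i)"
  unfolding pairing_def by (rule sum.mono_neutral_left) (use assms in auto)

lemma pairing_lincomb:
  assumes "a \<in> c00" "b \<in> c00"
  shows "pairing \<sigma> (\<lambda>i. r * a i + s * b i) = r * pairing \<sigma> a + s * pairing \<sigma> b"
proof -
  define S where "S = {i. a i \<noteq> 0} \<union> {i. b i \<noteq> 0}"
  have S: "finite S" using assms by (simp add: S_def c00_def)
  have "pairing \<sigma> (\<lambda>i. r * a i + s * b i) = (\<Sum>i\<in>S. \<sigma> i * (r * a i + s * b i))"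
    by (rule pairing_eq_sum[OF S]) (auto simp: S_def)
  also have "\<dots> = r * (\<Sum>i\<in>S. \<sigma> i * a i) + s * (\<Sum>i\<in>S. \<sigma> i * b i)"
    by (simp add: sum_distrib_left sum.distrib algebra_simps)
  also have "\<dots> = r * pairing \<sigma> a + s * pairing \<sigma> b"
    using pairing_eq_sum[OF S, of a \<sigma>] pairing_eq_sum[OF S, of b \<sigma>] by (simp add: S_def)
  finally show ?thesis .
qed

locale h1_completion =
  fixes \<A> :: "nat set set" and J :: "(nat \<Rightarrow> real) \<Rightarrow> 'b::banach"
  assumes adequate: "adequate_family \<A>"
    and finite_members: "\<And>A. A \<in> \<A> \<Longrightarrow> finite A"
    and completion: "is_h1_completion \<A> J"
begin

lemma empty_mem: "{} \<in> \<A>" and singleton_mem: "{i} \<in> \<A>"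
  and hereditary: "A \<in> \<A> \<Longrightarrow> B \<subseteq> A \<Longrightarrow> B \<in> \<A>"
  and finitary: "(\<And>F. finite F \<Longrightarrow> F \<subseteq> A \<Longrightarrow> F \<in> \<A>) \<Longrightarrow> A \<in> \<A>"
  using adequate unfolding adequate_family_def by blast+

lemma J_lincomb: "a \<in> c00 \<Longrightarrow> b \<in> c00 \<Longrightarrow> J (\<lambda>i. r * a i + s * b i) = r *\<^sub>R J a + s *\<^sub>R J b"
  and norm_J: "a \<in> c00 \<Longrightarrow> norm (J a) = h1_norm \<A> a"
  and dense_J: "closure (J ` c00) = UNIV"
  using completion unfolding is_h1_completion_def by blast+

section \<open>The signings as a norming set\<close>

lemma signings_c00: "\<sigma> \<in> signings \<A> \<Longrightarrow> \<sigma> \<in> c00"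
  using finite_members by (simp add: signings_def c00_def)

lemma signings_cases: "\<sigma> \<in> signings \<A> \<Longrightarrow> \<sigma> i = -1 \<or> \<sigma> i = 0 \<or> \<sigma> i = 1"
  by (auto simp: signings_def)

lemma pairing_le_norm:
  assumes a: "a \<in> c00" and \<sigma>: "\<sigma> \<in> signings \<A>"
  shows "\<bar>pairing \<sigma> a\<bar> \<le> norm (J a)"
proof -
  let ?S = "{i. a i \<noteq> 0}" let ?A = "{i. \<sigma> i \<noteq> 0}"
  have S: "finite ?S" using a by (simp add: c00_def)
  have A: "?A \<in> \<A>" using \<sigma> by (simp add: signings_def)
  have "\<bar>pairing \<sigma> a\<bar> \<le> (\<Sum>i\<in>?S. \<bar>\<sigma> i * a i\<bar>)" unfolding pairing_def by (rule sum_abs)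
  also have "\<dots> \<le> (\<Sum>i\<in>?A \<inter> ?S. \<bar>a i\<bar>)"
  proof -
    have "(\<Sum>i\<in>?S. \<bar>\<sigma> i * a i\<bar>) = (\<Sum>i\<in>?A \<inter> ?S. \<bar>\<sigma> i * a i\<bar>)"
      by (rule sum.mono_neutral_right) (use S in auto)
    also have "\<dots> \<le> (\<Sum>i\<in>?A \<inter> ?S. \<bar>a i\<bar>)"
    proof (rule sum_mono)
      fix i show "\<bar>\<sigma> i * a i\<bar> \<le> \<bar>a i\<bar>" using signings_cases[OF \<sigma>, of i] by auto
    qed
    finally show ?thesis .
  qed
  also have "\<dots> \<le> h1_norm \<A> a"
    unfolding h1_norm_def
  proof (rule cSUP_upper[OF A])
    \<comment> \<open>A real supremum is an upper bound only of a bounded set; the sum over the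
      whole support of \<open>a\<close> dominates all the others.\<close>
    show "bdd_above ((\<lambda>A. \<Sum>i\<in>A \<inter> ?S. \<bar>a i\<bar>) ` \<A>)"
      by (rule bdd_aboveI[of _ "\<Sum>i\<in>?S. \<bar>a i\<bar>"]) (use S in \<open>auto intro!: sum_mono2\<close>)
  qed
  also have "\<dots> = norm (J a)" using norm_J[OF a] by simp
  finally show ?thesis .
qed

lemma norm_le_pairing:
  assumes a: "a \<in> c00" and c: "\<And>\<sigma>. \<sigma> \<in> signings \<A> \<Longrightarrow> pairing \<sigma> a \<le> c"
  shows "norm (J a) \<le> c"
proof -
  have "(\<Sum>i\<in>A \<inter> {i. a i \<noteq> 0}. \<bar>a i\<bar>) \<le> c" if A: "A \<in> \<A>" for A
  proof -
    \<comment> \<open>The signs of \<open>a\<close> on \<open>A\<close> turn the sum of absolute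
      values into a pairing. The support shrinks where \<open>a\<close> vanishes, whence
      heredity.\<close>
    define \<sigma> where "\<sigma> i = (if i \<in> A then sgn (a i) else 0)" for i
    have S: "finite {i. a i \<noteq> 0}" using a by (simp add: c00_def)
    have "{i. \<sigma> i \<noteq> 0} \<in> \<A>" by (rule hereditary[OF A]) (auto simp: \<sigma>_def)
    then have "\<sigma> \<in> signings \<A>" by (auto simp: signings_def \<sigma>_def sgn_real_def)
    moreover have "(\<Sum>i\<in>A \<inter> {i. a i \<noteq> 0}. \<bar>a i\<bar>) = (\<Sum>i\<in>A \<inter> {i. a i \<noteq> 0}. \<sigma> i * a i)"
      by (rule sum.cong) (auto simp: \<sigma>_def sgn_real_def)
    moreover have "\<dots> = pairing \<sigma> a"
      unfolding pairing_def by (rule sum.mono_neutral_left) (use S in \<open>auto simp: \<sigma>_def\<close>)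
    ultimately show ?thesis using c by simp
  qed
  then show ?thesis
    unfolding norm_J[OF a] h1_norm_def by (rule cSUP_least[rotated]) (use empty_mem in auto)
qed

section \<open>Functionals on the completion\<close>

lemma norming_functional:
  fixes F :: "'b \<Rightarrow>\<^sub>L real"
  assumes "norm F > r" "r \<ge> 0"
  obtains a where "a \<in> c00" "norm (J a) \<le> 1" "F (J a) > r"
proof (rule ccontr)
  assume neg: "\<not> thesis"
  have le: "\<And>a. a \<in> c00 \<Longrightarrow> norm (J a) \<le> 1 \<Longrightarrow> F (J a) \<le> r" using neg that by force
  have scale: "(\<lambda>i. t * a i) \<in> c00 \<and> J (\<lambda>i. t * a i) = t *\<^sub>R J a" if "a \<in> c00" for a t
    using c00_lincomb[OF that that, of t 0] J_lincomb[OF that that, of t 0] by simp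
  \<comment> \<open>By homogeneity the bound on the unit ball becomes an inequality for all of
    \<open>c00\<close>; it is a closed condition, so density carries it to the whole space, and
    \<open>- z\<close> supplies the other sign.\<close>
  have bd: "F (J a) \<le> r * norm (J a)" if a: "a \<in> c00" for a
  proof (cases "norm (J a) = 0")
    case False
    have "F ((1 / norm (J a)) *\<^sub>R J a) \<le> r"
      using le[of "\<lambda>i. (1 / norm (J a)) * a i"] scale[OF a, of "1 / norm (J a)"] False
      by simp
    then show ?thesis using False by (simp add: blinfun.scaleR_right divide_simps)
  qed auto
  have "closed {z. F z \<le> r * norm z}"
    by (intro closed_Collect_le continuous_intros)
  then have "closure (J ` c00) \<subseteq> {z. F z \<le> r * norm z}"
    by (intro closure_minimal) (use bd in auto)
  then have all: "F z \<le> r * norm z" for z using dense_J by auto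
  have "norm (F z) \<le> r * norm z" for z
    using all[of z] all[of "- z"] by (simp add: blinfun.minus_right abs_le_iff)
  then show False using norm_blinfun_bound[OF assms(2)] assms(1) by (metis not_less)
qed

text \<open>Later the witness that \<open>bidual_embed e\<close> has norm 1. The pairing is
  1-Lipschitz on the image of \<open>c00\<close>; its Lipschitz extension is linear because
  linearity is a closed condition on pairs.\<close>

lemma signing_functional:
  assumes \<tau>: "\<tau> \<in> signings \<A>"
  obtains g :: "'b \<Rightarrow>\<^sub>L real" where "norm g \<le> 1" "\<And>a. a \<in> c00 \<Longrightarrow> g (J a) = pairing \<tau> a"
proof -
  have diff: "\<bar>pairing \<tau> a - pairing \<tau> b\<bar> \<le> norm (J a - J b)" if "a \<in> c00" "b \<in> c00" for a b
    using pairing_le_norm[OF c00_lincomb[OF that, of 1 "-1"] \<tau>]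
      pairing_lincomb[OF that, of \<tau> 1 "-1"] J_lincomb[OF that, of 1 "-1"] by simp
  \<comment> \<open>\<open>inv_into\<close> picks some preimage; by \<open>diff\<close> the pairing
    agrees on all sequences with the same image.\<close>
  define h0 where "h0 z = pairing \<tau> (inv_into c00 J z)" for z
  have h0: "h0 (J a) = pairing \<tau> a" if a: "a \<in> c00" for a
    using diff[of "inv_into c00 J (J a)" a] a
    by (simp add: h0_def inv_into_into f_inv_into_f)
  have "1-lipschitz_on (J ` c00) h0"
    by (rule lipschitz_onI) (use diff h0 in \<open>auto simp: dist_norm\<close>)
  then obtain h where h: "1-lipschitz_on (closure (J ` c00)) h" "\<And>z. z \<in> J ` c00 \<Longrightarrow> h z = h0 z"
    using lipschitz_extend_closure by metis
  have lip: "1-lipschitz_on UNIV h" using h(1) dense_J by simp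
  have cont: "continuous_on UNIV h" by (rule lipschitz_on_continuous_on[OF lip])
  have hJ: "h (J a) = pairing \<tau> a" if "a \<in> c00" for a using h(2) h0 that by auto
  have lin: "h (r *\<^sub>R u + s *\<^sub>R v) = r * h u + s * h v" for r s u v
  proof -
    have "closed {p :: 'b \<times> 'b. h (r *\<^sub>R fst p + s *\<^sub>R snd p) = r * h (fst p) + s * h (snd p)}"
      by (intro closed_Collect_eq continuous_intros continuous_on_compose2[OF cont]) auto
    then have "closure (J ` c00 \<times> J ` c00)
        \<subseteq> {p. h (r *\<^sub>R fst p + s *\<^sub>R snd p) = r * h (fst p) + s * h (snd p)}"
    proof (rule closure_minimal[rotated])
      show "J ` c00 \<times> J ` c00
          \<subseteq> {p. h (r *\<^sub>R fst p + s *\<^sub>R snd p) = r * h (fst p) + s * h (snd p)}"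
        using hJ c00_lincomb J_lincomb[symmetric] pairing_lincomb by auto
    qed
    moreover have "(u, v) \<in> closure (J ` c00 \<times> J ` c00)" by (simp add: closure_Times dense_J)
    ultimately have "(u, v) \<in> {p. h (r *\<^sub>R fst p + s *\<^sub>R snd p) = r * h (fst p) + s * h (snd p)}"
      by (rule subsetD)
    then show ?thesis by simp
  qed
  \<comment> \<open>\<open>lin\<close> with all arguments zero gives \<open>h 0 = 0\<close>, which
    turns the Lipschitz estimate into a norm bound.\<close>
  have bound: "norm (h z) \<le> norm z * 1" for z
    using lipschitz_onD[OF lip, of z 0] lin[of 0 0 0 0] by (simp add: dist_norm)
  have bl: "bounded_linear h"
  proof (rule bounded_linear_intro[OF _ _ bound])
    show "h (u + v) = h u + h v" for u v using lin[of 1 u 1 v] by simp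
    show "h (r *\<^sub>R u) = r *\<^sub>R h u" for r u using lin[of r u 0 u] by simp
  qed
  show thesis
  proof
    show "norm (Blinfun h) \<le> 1"
      by (rule norm_blinfun_bound) (use bound in \<open>auto simp: bounded_linear_Blinfun_apply[OF bl]\<close>)
    show "Blinfun h (J a) = pairing \<tau> a" if "a \<in> c00" for a
      using hJ[OF that] by (simp add: bounded_linear_Blinfun_apply[OF bl])
  qed
qed

section \<open>Signings with maximal support and their slices\<close>

lemma maximal_extension:
  assumes "A \<in> \<A>"
  obtains B where "A \<subseteq> B" "B \<in> \<A>" "\<And>C. C \<in> \<A> \<Longrightarrow> B \<subseteq> C \<Longrightarrow> C = B"
proof -
  let ?U = "{B \<in> \<A>. A \<subseteq> B}"
  have "\<exists>M\<in>?U. \<forall>X\<in>?U. M \<subseteq> X \<longrightarrow> X = M"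
  proof (rule subset_Zorn_nonempty)
    show "?U \<noteq> {}" using assms by auto
    fix \<C> assume \<C>: "\<C> \<noteq> {}" "subset.chain ?U \<C>"
    \<comment> \<open>Compactness of the family: a finite subset of the union of a chain already
      lies in one member of the chain.\<close>
    have "\<Union>\<C> \<in> \<A>"
    proof (rule finitary)
      fix F assume "finite F" "F \<subseteq> \<Union>\<C>"
      then obtain B where "B \<in> \<C>" "F \<subseteq> B" using finite_subset_Union_chain \<C> by metis
      then show "F \<in> \<A>" using \<C>(2) hereditary by (auto simp: subset.chain_def)
    qed
    moreover have "A \<subseteq> \<Union>\<C>" using \<C> by (fastforce simp: subset.chain_def)
    ultimately show "\<Union>\<C> \<in> ?U" by simp
  qed
  then obtain M where M: "M \<in> ?U" "\<forall>X\<in>?U. M \<subseteq> X \<longrightarrow> X = M" by (rule bexE)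
  show thesis
  proof (rule that[of M])
    show "C = M" if "C \<in> \<A>" "M \<subseteq> C" for C using M that by auto
  qed (use M in auto)
qed

text \<open>By maximality, a signing agreeing with \<open>\<tau>\<close> on the support of
  \<open>\<tau>\<close> is \<open>\<tau>\<close> itself. So \<open>\<sigma>\<close> differs at some
  \<open>i\<close> there, where it is zero or of opposite sign, and one full unit is lost.\<close>

lemma pairing_signings_le:
  assumes \<sigma>: "\<sigma> \<in> signings \<A>" and \<tau>: "\<tau> \<in> signings \<A>"
    and max: "\<And>C. C \<in> \<A> \<Longrightarrow> {i. \<tau> i \<noteq> 0} \<subseteq> C \<Longrightarrow> C = {i. \<tau> i \<noteq> 0}"
    and ne: "\<sigma> \<noteq> \<tau>"
  shows "pairing \<sigma> \<tau> \<le> real (card {i. \<tau> i \<noteq> 0}) - 1"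
proof -
  let ?B = "{i. \<tau> i \<noteq> 0}"
  have fin: "finite ?B" using signings_c00[OF \<tau>] by (simp add: c00_def)
  have "\<exists>i\<in>?B. \<sigma> i \<noteq> \<tau> i"
  proof (rule ccontr)
    assume "\<not> ?thesis"
    then have eq: "\<And>i. \<tau> i \<noteq> 0 \<Longrightarrow> \<sigma> i = \<tau> i" by auto
    then have "{i. \<sigma> i \<noteq> 0} = ?B" using \<sigma> by (intro max) (auto simp: signings_def)
    then have "\<sigma> i = \<tau> i" for i using eq[of i] by (cases "\<tau> i = 0") auto
    then show False using ne by auto
  qed
  then obtain i where i: "i \<in> ?B" "\<sigma> i \<noteq> \<tau> i" by auto
  have "\<sigma> i * \<tau> i \<le> 0" using i signings_cases[OF \<sigma>, of i] signings_cases[OF \<tau>, of i] by auto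
  moreover have "(\<Sum>j\<in>?B - {i}. \<sigma> j * \<tau> j) \<le> (\<Sum>j\<in>?B - {i}. 1)"
  proof (rule sum_mono)
    fix j show "\<sigma> j * \<tau> j \<le> 1"
      using signings_cases[OF \<sigma>, of j] signings_cases[OF \<tau>, of j] by auto
  qed
  moreover have "real (card (?B - {i})) = real (card ?B) - 1"
    using card_Suc_Diff1[OF fin i(1)] by linarith
  ultimately show ?thesis
    unfolding pairing_def using sum.remove[OF fin i(1), of "\<lambda>j. \<sigma> j * \<tau> j"] by simp
qed

text \<open>Quantitative strong exposure: as \<open>a\<close> may be replaced by its negative,
  \<open>y\<close> lies within \<open>K * (1 - y e)\<close> of the functional of
  \<open>\<tau>\<close>. The vector \<open>e\<close> is \<open>\<tau>\<close> divided by the size of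
  its support.\<close>

lemma maximal_signing_slice:
  assumes \<tau>: "\<tau> \<in> signings \<A>"
    and max: "\<And>C. C \<in> \<A> \<Longrightarrow> {i. \<tau> i \<noteq> 0} \<subseteq> C \<Longrightarrow> C = {i. \<tau> i \<noteq> 0}"
  obtains e :: 'b and K where "norm (bidual_embed e) = 1" "K > 0"
    "\<And>y a. norm y \<le> 1 \<Longrightarrow> a \<in> c00 \<Longrightarrow> norm (J a) \<le> 1
      \<Longrightarrow> pairing \<tau> a \<le> blinfun_apply y (J a) + K * (1 - blinfun_apply y e)"
proof -
  let ?B = "{i. \<tau> i \<noteq> 0}"
  define n where "n = real (card ?B)"
  have fin: "finite ?B" using signings_c00[OF \<tau>] by (simp add: c00_def)
  \<comment> \<open>An empty support would not be maximal, since it lies in a singleton.\<close>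
  have "?B \<noteq> {}" using max[OF singleton_mem[of 0]] by auto
  then have n: "n \<ge> 1" unfolding n_def using fin by (simp add: Suc_le_eq card_gt_0_iff)
  \<comment> \<open>The zero summand puts the scaled signing into the form of the lemmas on linear
    combinations.\<close>
  define a0 where "a0 = (\<lambda>i. (1 / n) * \<tau> i + 0 * \<tau> i)"
  have a0: "a0 \<in> c00" unfolding a0_def by (intro c00_lincomb signings_c00 \<tau>)
  have pa0: "pairing \<sigma> a0 = pairing \<sigma> \<tau> / n" for \<sigma>
    unfolding a0_def using pairing_lincomb[OF signings_c00[OF \<tau>] signings_c00[OF \<tau>], of \<sigma> "1/n" 0]
    by simp
  have "pairing \<tau> \<tau> = (\<Sum>i\<in>?B. 1)"
    unfolding pairing_def
  proof (rule sum.cong)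
    fix i assume "i \<in> ?B" then show "\<tau> i * \<tau> i = 1" using signings_cases[OF \<tau>, of i] by auto
  qed simp
  then have tau0: "pairing \<tau> a0 = 1" using n by (simp add: pa0 n_def)
  have sig0: "pairing \<sigma> a0 \<le> 1 - 1 / n" if "\<sigma> \<in> signings \<A>" "\<sigma> \<noteq> \<tau>" for \<sigma>
    using pairing_signings_le[OF that(1) \<tau> max that(2)] n
    by (simp add: pa0 n_def[symmetric] field_simps)
  have n0: "norm (J a0) \<le> 1"
  proof (rule norm_le_pairing[OF a0])
    fix \<sigma> assume "\<sigma> \<in> signings \<A>"
    then show "pairing \<sigma> a0 \<le> 1" using tau0 sig0[of \<sigma>] n by (cases "\<sigma> = \<tau>") (auto intro: order_trans)
  qed
  obtain g :: "'b \<Rightarrow>\<^sub>L real" where g: "norm g \<le> 1" "\<And>a. a \<in> c00 \<Longrightarrow> g (J a) = pairing \<tau> a"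
    using signing_functional[OF \<tau>] by blast
  have "bidual_embed (J a0) g = 1" using g(2)[OF a0] tau0 by simp
  then have "1 \<le> norm (bidual_embed (J a0)) * norm g"
    using norm_blinfun[of "bidual_embed (J a0)" g] by simp
  also have "\<dots> \<le> norm (bidual_embed (J a0))" using g(1) by (simp add: mult_left_le)
  finally have norm1: "norm (bidual_embed (J a0)) = 1"
    using norm_bidual_embed_le[of "J a0"] n0 by linarith
  have "pairing \<tau> a \<le> y (J a) + (2 * n + 1) * (1 - y (J a0))"
    if y: "norm y \<le> 1" and a: "a \<in> c00" "norm (J a) \<le> 1" for y :: "'b \<Rightarrow>\<^sub>L real" and a
  proof -
    define v where "v = (\<lambda>i. pairing \<tau> a * a0 i + (-1) * a i)"
    \<comment> \<open>Signings take values at most 2 on \<open>v\<close>, so the factor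
      \<open>1 / (2 * n)\<close> keeps the perturbation within \<open>1 / n\<close>.\<close>
    define w where "w = (\<lambda>i. 1 * a0 i + (1 / (2 * n)) * v i)"
    have v: "v \<in> c00" unfolding v_def by (intro c00_lincomb a0 a)
    have w: "w \<in> c00" unfolding w_def by (intro c00_lincomb a0 v)
    have pv: "pairing \<sigma> v = pairing \<tau> a * pairing \<sigma> a0 - pairing \<sigma> a" for \<sigma>
      unfolding v_def pairing_lincomb[OF a0 a(1)] by simp
    have pw: "pairing \<sigma> w = pairing \<sigma> a0 + pairing \<sigma> v / (2 * n)" for \<sigma>
      unfolding w_def pairing_lincomb[OF a0 v] by simp
    have Jw: "J w = J a0 + (1 / (2 * n)) *\<^sub>R (pairing \<tau> a *\<^sub>R J a0 - J a)"
      unfolding w_def J_lincomb[OF a0 v] unfolding v_def J_lincomb[OF a0 a(1)] by simp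
    have ta: "\<bar>pairing \<tau> a\<bar> \<le> 1" using pairing_le_norm[OF a(1) \<tau>] a(2) by linarith
    \<comment> \<open>\<open>v\<close> is annihilated by \<open>\<tau>\<close>, while every other signing leaves room \<open>1/n\<close> at \<open>a0\<close>.\<close>
    have "norm (J w) \<le> 1"
    proof (rule norm_le_pairing[OF w])
      fix \<sigma> assume \<sigma>: "\<sigma> \<in> signings \<A>"
      show "pairing \<sigma> w \<le> 1"
      proof (cases "\<sigma> = \<tau>")
        case True then show ?thesis by (simp add: pw pv tau0)
      next
        case False
        have "\<bar>pairing \<sigma> a0\<bar> \<le> 1" "\<bar>pairing \<sigma> a\<bar> \<le> 1"
          using pairing_le_norm[OF a0 \<sigma>] n0 pairing_le_norm[OF a(1) \<sigma>] a(2) by linarith+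
        moreover have "\<bar>pairing \<tau> a * pairing \<sigma> a0\<bar> \<le> 1"
          using ta \<open>\<bar>pairing \<sigma> a0\<bar> \<le> 1\<close> by (simp add: abs_mult mult_le_one)
        ultimately have "pairing \<sigma> v \<le> 2" unfolding pv by linarith
        then have "pairing \<sigma> v / (2 * n) \<le> 1 / n" using n by (simp add: field_simps)
        then show ?thesis using sig0[OF \<sigma> False] unfolding pw by linarith
      qed
    qed
    have le1: "y z \<le> 1" if "norm z \<le> 1" for z
      using norm_blinfun[of y z] mult_le_one[OF y norm_ge_zero that] by simp
    have "y (J a0) + (pairing \<tau> a * y (J a0) - y (J a)) / (2 * n) \<le> 1"
      using le1[OF \<open>norm (J w) \<le> 1\<close>]
      unfolding Jw by (simp add: blinfun.add_right blinfun.diff_right blinfun.scaleR_right)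
    then have "pairing \<tau> a * y (J a0) - y (J a) \<le> 2 * n * (1 - y (J a0))"
      using n by (simp add: field_simps)
    \<comment> \<open>Replacing \<open>pairing \<tau> a * y (J a0)\<close> by
      \<open>pairing \<tau> a\<close> costs at most \<open>1 - y (J a0)\<close>: this is the extra 1
      in \<open>2 * n + 1\<close>.\<close>
    moreover have "pairing \<tau> a * (1 - y (J a0)) \<le> 1 * (1 - y (J a0))"
      by (rule mult_right_mono) (use ta le1[OF n0] in auto)
    ultimately show ?thesis by (simp add: algebra_simps)
  qed
  then show thesis using that[OF norm1, of "2 * n + 1"] n by simp
qed

text \<open>A point \<open>y\<close> far from \<open>x\<close> in a thin slice is close to
  \<open>\<tau>\<close>. A vector almost norming \<open>x - y\<close> gives \<open>x\<close> nearly
  1 and \<open>y\<close>, hence \<open>\<tau>\<close>, nearly -1; as \<open>\<rho>\<close> gives at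
  most 1, the midpoint \<open>\<sigma>\<close> gives at most \<open>\<eta>\<close>.\<close>

lemma daugavet_point_signing:
  fixes x :: "'b \<Rightarrow>\<^sub>L real"
  assumes D: "daugavet_point x" and \<sigma>: "\<sigma> \<in> signings \<A>" and \<eta>: "\<eta> > 0" "\<eta> \<le> 1"
  obtains a where "a \<in> c00" "norm (J a) \<le> 1" "x (J a) > 1 - \<eta>" "pairing \<sigma> a \<le> \<eta>"
proof -
  obtain B where B: "{i. \<sigma> i \<noteq> 0} \<subseteq> B" "B \<in> \<A>" "\<And>C. C \<in> \<A> \<Longrightarrow> B \<subseteq> C \<Longrightarrow> C = B"
    using maximal_extension[of "{i. \<sigma> i \<noteq> 0}"] \<sigma> by (auto simp: signings_def)
  \<comment> \<open>\<open>\<sigma>\<close> is the midpoint of two signings with maximal support.\<close>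
  define \<tau> where "\<tau> i = (if \<sigma> i \<noteq> 0 then \<sigma> i else if i \<in> B then 1 else 0)" for i
  define \<rho> where "\<rho> = (\<lambda>i. 2 * \<sigma> i + (-1) * \<tau> i)"
  have supp: "{i. \<tau> i \<noteq> 0} = B" "{i. \<rho> i \<noteq> 0} = B" using B(1) by (auto simp: \<tau>_def \<rho>_def)
  have \<tau>: "\<tau> \<in> signings \<A>"
    using signings_cases[OF \<sigma>] B(2) supp by (auto simp: signings_def \<tau>_def)
  have "\<rho> i \<in> {-1, 0, 1}" for i
    using signings_cases[OF \<sigma>, of i] by (auto simp: \<rho>_def \<tau>_def)
  then have \<rho>: "\<rho> \<in> signings \<A>" using B(2) supp by (auto simp: signings_def)
  have max: "\<And>C. C \<in> \<A> \<Longrightarrow> {i. \<tau> i \<noteq> 0} \<subseteq> C \<Longrightarrow> C = {i. \<tau> i \<noteq> 0}"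
    using B(3) supp by simp
  obtain e :: 'b and K where e: "norm (bidual_embed e) = 1" "K > 0" and
    K: "\<And>y a. norm y \<le> 1 \<Longrightarrow> a \<in> c00 \<Longrightarrow> norm (J a) \<le> 1
      \<Longrightarrow> pairing \<tau> a \<le> blinfun_apply y (J a) + K * (1 - blinfun_apply y e)"
    using maximal_signing_slice[OF \<tau> max] by metis
  \<comment> \<open>Width \<open>\<eta> / K\<close> makes the error \<open>K * (1 - y e)\<close>
    less than \<open>\<eta>\<close>; distance \<open>2 - \<eta> / 2\<close> leaves room for the
    strict bound \<open>2 - \<eta>\<close>.\<close>
  have "bidual_embed e \<in> sphere 0 1" "\<eta> / K > 0" "\<eta> / 2 > 0" using e \<eta> by auto
  then obtain y where y: "y \<in> slice (bidual_embed e) (\<eta> / K)" "norm (x - y) \<ge> 2 - \<eta> / 2"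
    using D unfolding daugavet_point_def by blast
  have y1: "norm y \<le> 1" "y e > 1 - \<eta> / K" using y(1) by (auto simp: slice_def)
  have x1: "norm x \<le> 1" using D by (simp add: daugavet_point_def)
  obtain a where a: "a \<in> c00" "norm (J a) \<le> 1" "(x - y) (J a) > 2 - \<eta>"
    using norming_functional[of "2 - \<eta>" "x - y"] y(2) \<eta> by force
  have "\<bar>x (J a)\<bar> \<le> 1" "\<bar>y (J a)\<bar> \<le> 1"
    using norm_blinfun[of x "J a"] norm_blinfun[of y "J a"]
      mult_le_one[OF x1 norm_ge_zero a(2)] mult_le_one[OF y1(1) norm_ge_zero a(2)] by auto
  then have xa: "x (J a) > 1 - \<eta>" and ya: "y (J a) < -1 + \<eta>"
    using a(3) by (auto simp: blinfun.diff_left)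
  have "K * (1 - y e) < \<eta>" using y1(2) e(2) by (simp add: field_simps)
  then have "pairing \<tau> a \<le> -1 + 2 * \<eta>" using K[OF y1(1) a(1,2)] ya by linarith
  moreover have "pairing \<rho> a \<le> 1" using pairing_le_norm[OF a(1) \<rho>] a(2) by linarith
  moreover have "pairing \<rho> a = 2 * pairing \<sigma> a - pairing \<tau> a"
    unfolding \<rho>_def pairing_def by (simp add: algebra_simps sum_subtractf sum_distrib_left)
  ultimately have "pairing \<sigma> a \<le> \<eta>" by linarith
  with a xa show thesis using that by blast
qed

section \<open>Countability and compactness of the signings\<close>

lemma countable_signings: "countable (signings \<A>)"
proof -
  define f :: "nat set \<times> nat set \<Rightarrow> nat \<Rightarrow> real"
    where "f p i = (if i \<in> fst p then 1 else if i \<in> snd p then -1 else 0)" for p i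
  \<comment> \<open>A signing is determined by the two finite sets on which it is 1 and -1.\<close>
  have "signings \<A> \<subseteq> f ` ({A. finite A} \<times> {A. finite A})"
  proof
    fix \<sigma> assume \<sigma>: "\<sigma> \<in> signings \<A>"
    have fin: "finite {i. \<sigma> i \<noteq> 0}" using signings_c00[OF \<sigma>] by (simp add: c00_def)
    have "\<sigma> = f ({i. \<sigma> i = 1}, {i. \<sigma> i = -1})"
    proof
      fix i show "\<sigma> i = f ({i. \<sigma> i = 1}, {i. \<sigma> i = -1}) i"
        using signings_cases[OF \<sigma>, of i] by (auto simp: f_def)
    qed
    moreover have "finite {i. \<sigma> i = 1}" "finite {i. \<sigma> i = -1}"
      by (auto intro: finite_subset[OF _ fin])
    ultimately show "\<sigma> \<in> f ` ({A. finite A} \<times> {A. finite A})" by blast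
  qed
  moreover have "countable {A :: nat set. finite A}" using countable_Collect_finite by simp
  ultimately show ?thesis by (meson countable_SIGMA countable_image countable_subset)
qed

lemma compact_signings: "compact (signings \<A>)"
proof -
  \<comment> \<open>A support belongs to the family iff it contains no finite non-member
    \<open>F\<close>. For each \<open>F\<close> this says that some coordinate in \<open>F\<close>
    vanishes, a finite union of closed conditions on a compact product.\<close>
  have "signings \<A> = PiE UNIV (\<lambda>_. {-1, 0, 1}) \<inter>
      (\<Inter>F\<in>{F. finite F \<and> F \<notin> \<A>}. \<Union>i\<in>F. {\<sigma>. \<sigma> i = 0})" (is "_ = ?P \<inter> ?C")
  proof (intro set_eqI iffI)
    fix \<sigma> assume "\<sigma> \<in> signings \<A>"
    then have r: "range \<sigma> \<subseteq> {-1, 0, 1}" and A: "{i. \<sigma> i \<noteq> 0} \<in> \<A>" by (auto simp: signings_def)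
    have "\<exists>i\<in>F. \<sigma> i = 0" if "F \<notin> \<A>" for F
      using hereditary[OF A, of F] that by blast
    then show "\<sigma> \<in> ?P \<inter> ?C" using r by auto
  next
    fix \<sigma> assume \<sigma>: "\<sigma> \<in> ?P \<inter> ?C"
    have "{i. \<sigma> i \<noteq> 0} \<in> \<A>"
      by (rule finitary) (use \<sigma> in blast)
    then show "\<sigma> \<in> signings \<A>" using \<sigma> by (auto simp: signings_def PiE_iff)
  qed
  moreover have "compact ?P"
  proof -
    have "compactin (product_topology (\<lambda>_. euclidean) UNIV) ?P"
      unfolding compactin_PiE by (auto intro!: finite_imp_compact)
    then show ?thesis by (simp add: euclidean_product_topology)
  qed
  moreover have "closed ?C"
  proof (intro closed_INT ballI closed_UN)
    fix i :: nat
    show "closed {\<sigma> :: nat \<Rightarrow> real. \<sigma> i = 0}" by (intro closed_Collect_eq) auto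
  qed auto
  ultimately show ?thesis by (simp add: compact_Int_closed)
qed

section \<open>The finite subcover argument\<close>

lemma sum_c00:
  fixes N :: nat
  assumes "\<And>j. j < N \<Longrightarrow> a j \<in> c00"
  shows "(\<lambda>i. \<Sum>j<N. a j i) \<in> c00 \<and> J (\<lambda>i. \<Sum>j<N. a j i) = (\<Sum>j<N. J (a j)) \<and>
    (\<forall>\<sigma>. pairing \<sigma> (\<lambda>i. \<Sum>j<N. a j i) = (\<Sum>j<N. pairing \<sigma> (a j)))"
  using assms
proof (induction N)
  case 0
  have z: "(\<lambda>i. 0) \<in> c00" by (simp add: c00_def)
  show ?case using z J_lincomb[OF z z, of 0 0] by (simp add: pairing_def)
next
  case (Suc N)
  let ?b = "\<lambda>i. \<Sum>j<N. a j i"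
  have b: "?b \<in> c00" and a: "a N \<in> c00" using Suc by auto
  show ?case
    using c00_lincomb[OF b a, of 1 1] J_lincomb[OF b a, of 1 1]
      pairing_lincomb[OF b a, of _ 1 1] Suc by simp
qed

proposition no_daugavet_point:
  fixes x :: "'b \<Rightarrow>\<^sub>L real"
  shows "\<not> daugavet_point x"
proof
  assume D: "daugavet_point x"
  have ne: "signings \<A> \<noteq> {}"
    using empty_mem by (auto simp: signings_def intro!: exI[of _ "\<lambda>_. 0"])
  define \<kappa> where "\<kappa> = from_nat_into (signings \<A>)"
  have \<kappa>: "range \<kappa> = signings \<A>"
    unfolding \<kappa>_def using range_from_nat_into[OF ne countable_signings] .
  \<comment> \<open>The errors sum to less than 1/4, below the gain of 1/2 that the cover
    provides.\<close>
  define \<eta> :: "nat \<Rightarrow> real" where "\<eta> j = (1 / 2) ^ (j + 3)" for j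
  have \<eta>: "\<eta> j > 0" "\<eta> j \<le> 1 / 8" for j
    using power_decreasing[of 3 "j + 3" "1 / 2 :: real"] by (auto simp: \<eta>_def power3_eq_cube)
  have "\<exists>a. a \<in> c00 \<and> norm (J a) \<le> 1 \<and> x (J a) > 1 - \<eta> j \<and> pairing (\<kappa> j) a \<le> \<eta> j" for j
    using daugavet_point_signing[OF D, of "\<kappa> j" "\<eta> j"] \<kappa> \<eta>[of j] by fastforce
  then obtain a where a: "\<And>j. a j \<in> c00" "\<And>j. norm (J (a j)) \<le> 1" "\<And>j. x (J (a j)) > 1 - \<eta> j"
    "\<And>j. pairing (\<kappa> j) (a j) \<le> \<eta> j" by metis
  define U where "U j = {\<sigma>. pairing \<sigma> (a j) < 1 / 2}" for j
  have "open (U j)" for j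
    unfolding U_def pairing_def by (intro open_Collect_less continuous_intros) auto
  moreover have "signings \<A> \<subseteq> (\<Union>j\<in>UNIV. U j)"
  proof
    fix \<sigma> assume "\<sigma> \<in> signings \<A>"
    then obtain j where "\<sigma> = \<kappa> j" using \<kappa> by auto
    then have "\<sigma> \<in> U j" using a(4)[of j] \<eta>(2)[of j] by (simp add: U_def)
    then show "\<sigma> \<in> (\<Union>j\<in>UNIV. U j)" by blast
  qed
  ultimately obtain I where I: "finite I" "signings \<A> \<subseteq> (\<Union>j\<in>I. U j)"
    using compactE_image[OF compact_signings] by metis
  \<comment> \<open>Passing to an initial segment is harmless: each extra vector adds at most 1 to a
    pairing, and all errors together stay below 1/4.\<close>
  obtain N where N: "I \<subseteq> {..<N}" using finite_nat_iff_bounded I(1) by blast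
  define b where "b = (\<lambda>i. \<Sum>j<N. a j i)"
  have b: "b \<in> c00" "J b = (\<Sum>j<N. J (a j))" "\<And>\<sigma>. pairing \<sigma> b = (\<Sum>j<N. pairing \<sigma> (a j))"
    using sum_c00[of N a] a(1) by (auto simp: b_def)
  have "norm (J b) \<le> real N - 1 / 2"
  proof (rule norm_le_pairing[OF b(1)])
    fix \<sigma> assume \<sigma>: "\<sigma> \<in> signings \<A>"
    \<comment> \<open>The index \<open>k\<close> of a covering set saves 1/2; every other term is at
      most 1.\<close>
    then obtain k where k: "k < N" "pairing \<sigma> (a k) < 1 / 2" using I N by (auto simp: U_def)
    have "(\<Sum>j\<in>{..<N} - {k}. pairing \<sigma> (a j)) \<le> (\<Sum>j\<in>{..<N} - {k}. 1)"
    proof (rule sum_mono)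
      fix j show "pairing \<sigma> (a j) \<le> 1" using pairing_le_norm[OF a(1) \<sigma>, of j] a(2)[of j] by linarith
    qed
    moreover have "pairing \<sigma> b = pairing \<sigma> (a k) + (\<Sum>j\<in>{..<N} - {k}. pairing \<sigma> (a j))"
      unfolding b(3) by (rule sum.remove) (use k in auto)
    ultimately show "pairing \<sigma> b \<le> real N - 1 / 2" using k by (simp add: of_nat_diff)
  qed
  moreover have "x (J b) \<le> norm (J b)"
    using norm_blinfun[of x "J b"] D by (simp add: daugavet_point_def)
  moreover have "x (J b) \<ge> real N - 1 / 4"
  proof -
    have "(\<Sum>j<N. \<eta> j) \<le> 1 / 4"
    proof -
      have "(\<Sum>j<N. \<eta> j) = 1 / 4 - (1 / 2) ^ N / 4"
        by (induction N) (auto simp: \<eta>_def power_add power3_eq_cube)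
      then show ?thesis by simp
    qed
    moreover have "(\<Sum>j<N. x (J (a j))) \<ge> (\<Sum>j<N. 1 - \<eta> j)"
      by (rule sum_mono) (use a(3) less_imp_le in blast)
    ultimately show ?thesis by (simp add: b(2) blinfun.sum_right sum_subtractf)
  qed
  ultimately show False by linarith
qed

end

theorem proposition4p10:
  "(\<forall>(x :: 'a::banach \<Rightarrow>\<^sub>L real) (c :: nat \<Rightarrow> real) (f :: nat \<Rightarrow> 'a \<Rightarrow>\<^sub>L real).
      x \<in> sphere 0 1 \<and> (\<forall>i. c i \<ge> 0) \<and> c sums 1 \<and>
      (\<forall>i. strongly_exposed (f i)) \<and> (\<lambda>i. c i *\<^sub>R f i) sums x
      \<longrightarrow> \<not> daugavet_point x) \<and>
   (\<forall>(x :: 'a::banach \<Rightarrow>\<^sub>L real) (c :: nat \<Rightarrow> real) (f :: nat \<Rightarrow> 'a \<Rightarrow>\<^sub>L real).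
      x \<in> sphere 0 1 \<and> (\<forall>i. c i \<ge> 0) \<and> c sums 1 \<and>
      (\<forall>i. wstar_strongly_exposed (f i)) \<and> (\<lambda>i. c i *\<^sub>R f i) sums x
      \<longrightarrow> \<not> daugavet_point x) \<and>
   (\<forall>(\<A> :: nat set set) (J :: (nat \<Rightarrow> real) \<Rightarrow> 'b::banach).
      adequate_family \<A> \<and> (\<forall>A \<in> \<A>. finite A) \<and> is_h1_completion \<A> J
      \<longrightarrow> \<not> (\<exists>x :: 'b \<Rightarrow>\<^sub>L real. daugavet_point x))"
proof (intro conjI allI impI)
  fix x :: "'a \<Rightarrow>\<^sub>L real" and c f
  assume "x \<in> sphere 0 1 \<and> (\<forall>i. c i \<ge> 0) \<and> c sums 1 \<and>
      (\<forall>i. strongly_exposed (f i)) \<and> (\<lambda>i. c i *\<^sub>R f i) sums x"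
  then show "\<not> daugavet_point x"
    using not_daugavet_point_convex_series_strongly_exposed by blast
next
  fix x :: "'a \<Rightarrow>\<^sub>L real" and c f
  assume "x \<in> sphere 0 1 \<and> (\<forall>i. c i \<ge> 0) \<and> c sums 1 \<and>
      (\<forall>i. wstar_strongly_exposed (f i)) \<and> (\<lambda>i. c i *\<^sub>R f i) sums x"
  then show "\<not> daugavet_point x"
    using not_daugavet_point_convex_series_strongly_exposed
      wstar_strongly_exposed_imp_strongly_exposed by blast
next
  fix \<A> :: "nat set set" and J :: "(nat \<Rightarrow> real) \<Rightarrow> 'b"
  assume "adequate_family \<A> \<and> (\<forall>A \<in> \<A>. finite A) \<and> is_h1_completion \<A> J"
  then interpret h1_completion \<A> J by unfold_locales auto
  show "\<not> (\<exists>x :: 'b \<Rightarrow>\<^sub>L real. daugavet_point x)" using no_daugavet_point by blast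
qed

end
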